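(* For real $s>0$ let $A_s$ be the infinite matrix with entries $(A_s)_{ij}=\frac{1}{\max(i,j)+s}$, $i,j\in\{0,1,2,\dots\}$, and let $$s_0:=\inf\{s>0:\ \|A_s\|_{\ell^2\to\ell^2}=4\}.$$ Then $$\frac{\sqrt{6(8+3\sqrt{3})}-\sqrt{3}-3}{12}\ \leq\ s_0\ \leq\ \frac{1}{2\sqrt{2}}.$$
   Context: Matrix and sequence indices start from $0$. For a sequence $(a_n)_{n\ge 0}$, the $L$-matrix $A=[a_n]$ is the infinite matrix whose $(i,j)$ entry is $a_{\max(i,j)}$, $i,j\ge 0$; thus $A_s=[1/(n+s)]$ is the $L$-matrix with $a_n=\frac{1}{n+s}$. The matrix acts on sequences $x=(x_j)_{j\ge0}$ by $(A_s x)_i=\sum_{j\ge 0}(A_s)_{ij}x_j$, and $\|A_s\|_{\ell^2\to\ell^2}=\sup_{x\neq 0}\|A_sx\|_2/\|x\|_2$ is its operator norm on $\ell^2$, the space of square-summable sequences indexed by $\{0,1,2,\dots\}$. *)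

theory Defs
  imports "HOL-Analysis.Analysis"
begin

text \<open>Infinite matrices are functions \<^typ>\<open>nat \<Rightarrow> nat \<Rightarrow> real\<close>, sequences are functions
  \<^typ>\<open>nat \<Rightarrow> real\<close>; the scalars are real.\<close>

definition L_matrix :: "(nat \<Rightarrow> real) \<Rightarrow> nat \<Rightarrow> nat \<Rightarrow> real" where
  "L_matrix a i j = a (max i j)"

definition A_mat :: "real \<Rightarrow> nat \<Rightarrow> nat \<Rightarrow> real" where
  "A_mat s = L_matrix (\<lambda>n. 1 / (real n + s))"

definition ell2 :: "(nat \<Rightarrow> real) set" where
  "ell2 = {x. summable (\<lambda>n. (x n)\<^sup>2)}"

text \<open>The norm is extended-real valued, so that the image of a sequence under an unbounded matrix
  has norm \<open>\<infinity>\<close> when it leaves \<open>ell2\<close>.\<close>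

definition ell2_norm :: "(nat \<Rightarrow> real) \<Rightarrow> ereal" where
  "ell2_norm x = (if x \<in> ell2 then ereal (sqrt (\<Sum>n. (x n)\<^sup>2)) else \<infinity>)"

text \<open>The value \<open>suminf\<close> is meaningful only for convergent row sums. For \<open>A_mat s\<close> with \<open>s > 0\<close>
  every row is square-summable, so the row sums converge absolutely for all \<open>x \<in> ell2\<close>.\<close>

definition mat_apply :: "(nat \<Rightarrow> nat \<Rightarrow> real) \<Rightarrow> (nat \<Rightarrow> real) \<Rightarrow> nat \<Rightarrow> real" where
  "mat_apply A x i = (\<Sum>j. A i j * x j)"

definition ell2_opnorm :: "(nat \<Rightarrow> nat \<Rightarrow> real) \<Rightarrow> ereal" where
  "ell2_opnorm A = (SUP x\<in>ell2 - {\<lambda>_. 0}. ell2_norm (mat_apply A x) / ell2_norm x)"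

text \<open>A real infimum: the set is bounded below by 0, but \<open>Inf\<close> is unspecified on the empty set, so
  any bound on \<open>s0\<close> has to rest on the set being nonempty.\<close>

definition s0 :: real where
  "s0 = Inf {s. s > 0 \<and> ell2_opnorm (A_mat s) = 4}"

end

theory Submission imports Defs begin

text \<open>
  Summation by parts diagonalises an \<open>L\<close>-matrix: with partial sums
  \<open>S\<^sub>n = x\<^sub>0 + \<dots> + x\<^sub>n\<close>, the form of \<open>[a\<^sub>n]\<close> at \<open>x\<close> is the sum of
  \<open>(a\<^sub>n - a\<^sub>n\<^sub>+\<^sub>1) S\<^sub>n\<^sup>2\<close> (lemma \<open>L_matrix_form\<close>), while \<open>x\<^sub>n = S\<^sub>n - S\<^sub>n\<^sub>-\<^sub>1\<close>.
  Hence \<open>\<parallel>A\<^sub>s\<parallel> \<le> \<lambda>\<close> is a discrete Hardy inequality, governed by the three-term recurrence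
  \<open>\<lambda> (2 g\<^sub>n - g\<^sub>n\<^sub>-\<^sub>1 - g\<^sub>n\<^sub>+\<^sub>1) = g\<^sub>n / ((n + s) (n + s + 1))\<close>, \<open>g\<^sub>-\<^sub>1 = 0\<close>:
  a positive supersolution with suitable boundary behaviour makes its increments a Schur test
  vector, and the norm is at most \<open>\<lambda>\<close> (\<open>L_matrix_opnorm_le\<close>); a subsolution that loses its sign
  gives, cut off at its first sign change, a finitely supported \<open>x\<close> whose Rayleigh quotient
  exceeds \<open>\<lambda>\<close> (\<open>L_matrix_opnorm_gt\<close>).

  At the critical value \<open>\<lambda> = 4\<close> both kinds of comparison sequence come from one family,
  \<open>half_ratio c n\<close>, a quotient of Pochhammer symbols growing like \<open>\<surd>n\<close>, which satisfies the
  recurrence exactly with \<open>(n + c) (n + c - 1/2)\<close> in place of \<open>(n + s) (n + s + 1)\<close>.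
  For \<open>s = 1 / (2 \<surd>2)\<close> the shift \<open>c = 21/20\<close> gives a supersolution, so the norm is at most \<open>4\<close>;
  it is at least \<open>4\<close> by testing with \<open>x\<^sub>j = 1 / \<surd>(j + 1)\<close>. Thus \<open>1 / (2 \<surd>2)\<close> lies in the set
  that defines \<open>s0\<close>. For \<open>s \<le> 139/400\<close>, a number slightly above the claimed lower bound, three
  explicit values of a subsolution are continued by the second solution of a comparison recurrence,
  \<open>h\<^sub>n (1 - \<epsilon> \<Sum>\<^sub>k\<^sub><\<^sub>n 1 / (h\<^sub>k h\<^sub>k\<^sub>+\<^sub>1))\<close>. As \<open>h\<^sub>k h\<^sub>k\<^sub>+\<^sub>1\<close> grows only linearly, the series diverges,
  so the subsolution changes sign and the norm exceeds \<open>4\<close>. The sign change comes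
  astronomically late, which is why it is deduced from divergence and not from computed values.
\<close>

section \<open>Forms of L-matrices and Rayleigh quotients\<close>

lemma L_matrix_form:
  "(\<Sum>i\<le>N. \<Sum>j\<le>N. L_matrix a i j * x i * x j)
     = (\<Sum>n<N. (a n - a (Suc n)) * (\<Sum>j\<le>n. x j)\<^sup>2) + a N * (\<Sum>j\<le>N. x j)\<^sup>2"
proof (induction N)
  case 0
  show ?case by (simp add: L_matrix_def power2_eq_square)
next
  case (Suc N)
  have row: "(\<Sum>j\<le>N. L_matrix a (Suc N) j * x (Suc N) * x j) = a (Suc N) * x (Suc N) * (\<Sum>j\<le>N. x j)"
    by (simp add: L_matrix_def sum_distrib_left max_def)
  have col: "(\<Sum>i\<le>N. L_matrix a i (Suc N) * x i * x (Suc N)) = a (Suc N) * x (Suc N) * (\<Sum>j\<le>N. x j)"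
    by (simp add: L_matrix_def sum_distrib_left max_def mult_ac)
  have "(\<Sum>i\<le>Suc N. \<Sum>j\<le>Suc N. L_matrix a i j * x i * x j)
      = (\<Sum>i\<le>N. \<Sum>j\<le>N. L_matrix a i j * x i * x j)
        + (\<Sum>i\<le>N. L_matrix a i (Suc N) * x i * x (Suc N))
        + (\<Sum>j\<le>N. L_matrix a (Suc N) j * x (Suc N) * x j) + a (Suc N) * (x (Suc N))\<^sup>2"
    by (simp add: sum.distrib L_matrix_def power2_eq_square)
  then show ?case
    unfolding row col Suc.IH by (simp add: power2_eq_square algebra_simps)
qed

text \<open>Cauchy-Schwarz applied to \<open>x\<close> and the first entries of its image. When the image leaves
  \<^const>\<open>ell2\<close> the quotient of norms is infinite and there is nothing to compare.\<close>

lemma Rayleigh_le_ell2_opnorm: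
  fixes x :: "nat \<Rightarrow> real"
  assumes pos: "0 < (\<Sum>j\<le>N. (x j)\<^sup>2)"
  shows "ereal ((\<Sum>i\<le>N. \<Sum>j\<le>N. A i j * x i * x j) / (\<Sum>j\<le>N. (x j)\<^sup>2)) \<le> ell2_opnorm A"
proof -
  define v where "v j = (if j \<le> N then x j else 0)" for j
  define y where "y = mat_apply A v"
  define X where "X = (\<Sum>j\<le>N. (x j)\<^sup>2)"
  have vsums: "(\<lambda>j. (v j)\<^sup>2) sums X"
    using sums_finite[of "{..N}" "\<lambda>j. (v j)\<^sup>2"] by (simp add: v_def X_def)
  then have vin: "v \<in> ell2"
    by (auto simp: ell2_def sums_iff)
  have vnorm: "ell2_norm v = ereal (sqrt X)"
    using vin vsums by (simp add: ell2_norm_def sums_iff)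
  have X0: "0 < X"
    using pos by (simp add: X_def)
  have vne: "v \<noteq> (\<lambda>_. 0)"
  proof
    assume "v = (\<lambda>_. 0)"
    with vsums have "X = 0" by (simp add: sums_iff)
    with X0 show False by simp
  qed
  have yrow: "y i = (\<Sum>j\<le>N. A i j * x j)" for i
  proof -
    have "y i = (\<Sum>j\<le>N. A i j * v j)"
      unfolding y_def mat_apply_def by (rule suminf_finite) (auto simp: v_def)
    also have "\<dots> = (\<Sum>j\<le>N. A i j * x j)"
      by (rule sum.cong) (auto simp: v_def)
    finally show ?thesis .
  qed
  have form: "(\<Sum>i\<le>N. \<Sum>j\<le>N. A i j * x i * x j) = (\<Sum>i\<le>N. x i * y i)"
    by (simp add: yrow sum_distrib_left mult_ac)
  have "ereal ((\<Sum>i\<le>N. x i * y i) / X) \<le> ell2_norm y / ell2_norm v"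
  proof (cases "y \<in> ell2")
    case False
    then show ?thesis using X0 by (simp add: ell2_norm_def[of y] vnorm)
  next
    case True
    define Y where "Y = (\<Sum>n. (y n)\<^sup>2)"
    have "(\<Sum>i\<le>N. (y i)\<^sup>2) \<le> Y"
      unfolding Y_def using True by (intro sum_le_suminf) (auto simp: ell2_def)
    moreover have "\<bar>\<Sum>i\<le>N. x i * y i\<bar> \<le> L2_set x {..N} * L2_set y {..N}"
      using L2_set_mult_ineq[of x y "{..N}"] sum_abs[of "\<lambda>i. x i * y i" "{..N}"]
      by (simp add: abs_mult)
    ultimately have "(\<Sum>i\<le>N. x i * y i) \<le> sqrt X * sqrt Y"
      unfolding L2_set_def X_def[symmetric]
      by (smt (verit) mult_left_mono real_sqrt_ge_zero real_sqrt_le_iff X0)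
    then have "(\<Sum>i\<le>N. x i * y i) / X \<le> sqrt X * sqrt Y / (sqrt X * sqrt X)"
      using X0 by (simp add: divide_right_mono)
    also have "\<dots> = sqrt Y / sqrt X"
      using X0 by (intro mult_divide_mult_cancel_left) simp
    finally have "(\<Sum>i\<le>N. x i * y i) / X \<le> sqrt Y / sqrt X" .
    then show ?thesis
      using True X0 by (simp add: ell2_norm_def[of y] vnorm Y_def)
  qed
  also have "\<dots> \<le> ell2_opnorm A"
    unfolding ell2_opnorm_def y_def using vin vne by (intro SUP_upper) auto
  finally show ?thesis
    by (simp add: form X_def)
qed

section \<open>Oscillating subsolutions force a large norm\<close>

text \<open>The discrete Green formula; the last term vanishes for a sequence cut off at \<open>Suc m\<close>.\<close>

lemma sum_squares_increments:
  fixes T :: "nat \<Rightarrow> real"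
  assumes "T 0 = 0"
  shows "(\<Sum>j\<le>m. (T (Suc j) - T j)\<^sup>2)
      = (\<Sum>k<m. T (Suc k) * (2 * T (Suc k) - T k - T (Suc (Suc k)))) + T (Suc m) * (T (Suc m) - T m)"
  by (induction m) (simp_all add: assms power2_eq_square algebra_simps)

text \<open>
  Sturm comparison. Here \<open>T\<close> is shifted by one, so that the Dirichlet condition sits at \<open>T 0\<close>.
  Where \<open>T\<close> is positive before its first nonpositive value, the inequality sees no later term;
  raising that value to \<open>0\<close> preserves the inequality and allows a cut-off there. The increments \<open>x\<close> of the truncated sequence
  have its values as partial sums, and weighting the inequality by them compares
  \<open>lam * \<parallel>x\<parallel>\<^sup>2\<close> with the form at \<open>x\<close>. Strictness at the first index makes the comparison strict.
\<close>

lemma L_matrix_opnorm_gt: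
  fixes T a :: "nat \<Rightarrow> real"
  assumes lam: "0 < lam"
    and T0: "T 0 = 0" and T1: "0 < T 1"
    and sub: "\<And>k. 0 < T (Suc k) \<Longrightarrow>
        lam * (2 * T (Suc k) - T k - T (Suc (Suc k))) \<le> (a k - a (Suc k)) * T (Suc k)"
    and strict: "lam * (2 * T 1 - T 2) < (a 0 - a 1) * T 1"
    and osc: "\<exists>n>0. T n \<le> 0"
  shows "ereal lam < ell2_opnorm (L_matrix a)"
proof -
  define m where "m = (LEAST n. 0 < n \<and> T n \<le> 0)"
  have m: "0 < m" "T m \<le> 0"
    using LeastI_ex[OF osc[unfolded Bex_def]] by (auto simp: m_def)
  have Tpos: "0 < T n" if "0 < n" "n < m" for n
    using not_less_Least[of n "\<lambda>n. 0 < n \<and> T n \<le> 0"] that by (auto simp: m_def)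
  have "m \<noteq> 1" using m T1 by auto
  with m obtain M where M: "m = Suc (Suc M)"
    by (metis One_nat_def gr0_conv_Suc not_gr0)
  define U where "U n = (if n \<le> Suc M then T n else 0)" for n
  define x where "x j = U (Suc j) - U j" for j
  have U0: "U 0 = 0" by (simp add: U_def T0)
  have psum: "(\<Sum>j\<le>n. x j) = U (Suc n)" for n
    by (induction n) (simp_all add: x_def U0)
  have step: "lam * (U (Suc k) * (2 * U (Suc k) - U k - U (Suc (Suc k))))
       \<le> (a k - a (Suc k)) * (U (Suc k))\<^sup>2" if "k < Suc M" for k
  proof -
    have pos: "0 < T (Suc k)" using Tpos that M by simp
    have "T (Suc (Suc k)) \<le> U (Suc (Suc k))"
      using that m M by (auto simp: U_def not_less_eq_eq le_Suc_eq)
    then have "lam * (2 * T (Suc k) - T k - U (Suc (Suc k))) \<le> lam * (2 * T (Suc k) - T k - T (Suc (Suc k)))"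
      using lam by simp
    also have "\<dots> \<le> (a k - a (Suc k)) * T (Suc k)"
      by (rule sub[OF pos])
    finally have "T (Suc k) * (lam * (2 * T (Suc k) - T k - U (Suc (Suc k)))) \<le> T (Suc k) * ((a k - a (Suc k)) * T (Suc k))"
      using pos by (intro mult_left_mono) auto
    then show ?thesis
      using that by (simp add: U_def power2_eq_square mult_ac)
  qed
  have strict0: "lam * (U (Suc 0) * (2 * U (Suc 0) - U 0 - U (Suc (Suc 0))))
       < (a 0 - a (Suc 0)) * (U (Suc 0))\<^sup>2"
  proof -
    have "T 2 \<le> U 2"
      using m M by (cases M) (auto simp: U_def numeral_2_eq_2)
    then have "lam * (2 * T 1 - U 2) \<le> lam * (2 * T 1 - T 2)"
      using lam by simp
    also have "\<dots> < (a 0 - a 1) * T 1" by (rule strict)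
    finally have "T 1 * (lam * (2 * T 1 - U 2)) < T 1 * ((a 0 - a 1) * T 1)"
      using T1 by (intro mult_strict_left_mono)
    then show ?thesis
      by (simp add: U_def T0 power2_eq_square mult_ac numeral_2_eq_2)
  qed
  define X where "X = (\<Sum>j\<le>Suc M. (x j)\<^sup>2)"
  define Q where "Q = (\<Sum>i\<le>Suc M. \<Sum>j\<le>Suc M. L_matrix a i j * x i * x j)"
  have "lam * X = (\<Sum>k<Suc M. lam * (U (Suc k) * (2 * U (Suc k) - U k - U (Suc (Suc k)))))"
    unfolding X_def x_def sum_squares_increments[of U, OF U0] by (simp add: sum_distrib_left distrib_left U_def)
  also have "\<dots> < (\<Sum>k<Suc M. (a k - a (Suc k)) * (U (Suc k))\<^sup>2)"
    by (rule sum_strict_mono_ex1) (use step strict0 in auto)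
  also have "\<dots> = Q"
    unfolding Q_def L_matrix_form psum by (simp add: U_def)
  finally have less: "lam * X < Q" .
  have "0 < (x 0)\<^sup>2"
    using T1 T0 by (simp add: x_def U_def)
  then have X0: "0 < X"
    unfolding X_def by (intro sum_pos2[of _ 0]) auto
  have "ereal lam < ereal (Q / X)"
    using less X0 by (simp add: field_simps)
  also have "\<dots> \<le> ell2_opnorm (L_matrix a)"
    unfolding Q_def X_def by (rule Rayleigh_le_ell2_opnorm) (use X0 X_def in simp)
  finally show ?thesis .
qed

section \<open>Positive supersolutions bound the norm\<close>

text \<open>Cauchy-Schwarz on each row with the splitting
  \<open>A i j * x j = sqrt (A i j * p j) * (sqrt (A i j / p j) * x j)\<close>.\<close>

lemma Schur_test_finite:
  fixes A :: "nat \<Rightarrow> nat \<Rightarrow> real"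
  assumes A0: "\<And>i j. 0 \<le> A i j" and sym: "\<And>i j. A i j = A j i"
    and p: "\<And>i. 0 < p i"
    and row: "\<And>i. i \<le> N \<Longrightarrow> (\<Sum>j\<le>N. A i j * p j) \<le> lam * p i"
  shows "(\<Sum>i\<le>N. (\<Sum>j\<le>N. A i j * x j)\<^sup>2) \<le> lam\<^sup>2 * (\<Sum>j\<le>N. (x j)\<^sup>2)"
proof -
  have "0 \<le> lam * p 0"
    using row[of 0] sum_nonneg[of "{..N}" "\<lambda>j. A 0 j * p j"] A0 p by (smt (verit) le0 mult_nonneg_nonneg)
  then have lam0: "0 \<le> lam" using p[of 0] by (simp add: zero_le_mult_iff)
  have cs: "(\<Sum>j\<le>N. A i j * x j)\<^sup>2 \<le> lam * p i * (\<Sum>j\<le>N. A i j * ((x j)\<^sup>2 / p j))"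
    if "i \<le> N" for i
  proof -
    have "(\<Sum>j\<le>N. A i j * x j) = (\<Sum>j\<le>N. sqrt (A i j * p j) * (sqrt (A i j / p j) * x j))"
      using A0 p by (intro sum.cong) (auto simp: real_sqrt_mult real_sqrt_divide less_imp_neq[symmetric] field_simps)
    then have "(\<Sum>j\<le>N. A i j * x j)\<^sup>2
        \<le> (\<Sum>j\<le>N. (sqrt (A i j * p j))\<^sup>2) * (\<Sum>j\<le>N. (sqrt (A i j / p j) * x j)\<^sup>2)"
      by (simp add: Cauchy_Schwarz_ineq_sum)
    also have "\<dots> = (\<Sum>j\<le>N. A i j * p j) * (\<Sum>j\<le>N. A i j * ((x j)\<^sup>2 / p j))"
      using A0 p by (simp add: power_mult_distrib less_imp_le)
    also have "\<dots> \<le> lam * p i * (\<Sum>j\<le>N. A i j * ((x j)\<^sup>2 / p j))"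
      using row[OF that] A0 p by (intro mult_right_mono sum_nonneg mult_nonneg_nonneg) (auto simp: less_imp_le)
    finally show ?thesis .
  qed
  have "(\<Sum>i\<le>N. (\<Sum>j\<le>N. A i j * x j)\<^sup>2) \<le> (\<Sum>i\<le>N. lam * p i * (\<Sum>j\<le>N. A i j * ((x j)\<^sup>2 / p j)))"
    by (intro sum_mono cs) simp
  also have "\<dots> = lam * (\<Sum>i\<le>N. \<Sum>j\<le>N. (x j)\<^sup>2 / p j * (A i j * p i))"
    by (simp add: sum_distrib_left mult_ac)
  also have "\<dots> = lam * (\<Sum>j\<le>N. (x j)\<^sup>2 / p j * (\<Sum>i\<le>N. A j i * p i))"
    by (subst sum.swap) (simp add: sum_distrib_left sym)
  also have "\<dots> \<le> lam * (\<Sum>j\<le>N. (x j)\<^sup>2 / p j * (lam * p j))"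
    using row p lam0 by (intro mult_left_mono sum_mono) (auto simp: less_imp_le)
  also have "\<dots> = lam\<^sup>2 * (\<Sum>j\<le>N. (x j)\<^sup>2)"
    using p by (simp add: less_imp_neq[symmetric] sum_distrib_left power2_eq_square mult_ac)
  finally show ?thesis .
qed

text \<open>For a matrix with nonnegative entries, uniform bounds on the sections already give absolute
  convergence of the row sums: the section bound for \<open>\<bar>x\<bar>\<close> controls their partial sums.\<close>

lemma ell2_opnorm_le_finite_sections:
  fixes A :: "nat \<Rightarrow> nat \<Rightarrow> real"
  assumes A0: "\<And>i j. 0 \<le> A i j" and lam0: "0 \<le> lam"
    and fin: "\<And>x N. (\<Sum>i\<le>N. (\<Sum>j\<le>N. A i j * x j)\<^sup>2) \<le> lam\<^sup>2 * (\<Sum>j\<le>N. (x j)\<^sup>2)"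
  shows "ell2_opnorm A \<le> ereal lam"
  unfolding ell2_opnorm_def
proof (rule SUP_least)
  fix x :: "nat \<Rightarrow> real"
  assume "x \<in> ell2 - {\<lambda>_. 0}"
  then have xs: "summable (\<lambda>n. (x n)\<^sup>2)" and xin: "x \<in> ell2" and xne: "\<exists>n. x n \<noteq> 0"
    by (auto simp: ell2_def)
  define X where "X = (\<Sum>n. (x n)\<^sup>2)"
  have Xge: "(\<Sum>n\<le>N. (x n)\<^sup>2) \<le> X" for N
    unfolding X_def using xs by (intro sum_le_suminf) auto
  have X0: "0 < X"
    unfolding X_def using xne by (auto intro!: suminf_pos2 xs)
  have sec: "(\<Sum>i\<le>K. (\<Sum>j\<le>N. A i j * z j)\<^sup>2) \<le> lam\<^sup>2 * X"
    if "K \<le> N" and z: "\<And>j. (z j)\<^sup>2 = (x j)\<^sup>2" for K N z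
  proof -
    have "(\<Sum>i\<le>K. (\<Sum>j\<le>N. A i j * z j)\<^sup>2) \<le> (\<Sum>i\<le>N. (\<Sum>j\<le>N. A i j * z j)\<^sup>2)"
      using that by (intro sum_mono2) auto
    also have "\<dots> \<le> lam\<^sup>2 * X"
      using fin[of z N] mult_left_mono[OF Xge[of N], of "lam\<^sup>2"] by (simp add: z)
    finally show ?thesis .
  qed
  have rows: "summable (\<lambda>j. A i j * x j)" for i
  proof (rule summable_norm_cancel, rule bounded_imp_summable)
    fix n
    define N where "N = max i n"
    have "(\<Sum>j\<le>N. A i j * \<bar>x j\<bar>)\<^sup>2 \<le> (\<Sum>i\<le>N. (\<Sum>j\<le>N. A i j * \<bar>x j\<bar>)\<^sup>2)"
      by (rule member_le_sum) (auto simp: N_def)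
    also have "\<dots> \<le> lam\<^sup>2 * X"
      by (rule sec) auto
    finally have "(\<Sum>j\<le>N. A i j * \<bar>x j\<bar>) \<le> sqrt (lam\<^sup>2 * X)"
      by (rule real_le_rsqrt)
    moreover have "(\<Sum>j\<le>n. A i j * \<bar>x j\<bar>) \<le> (\<Sum>j\<le>N. A i j * \<bar>x j\<bar>)"
      using A0 by (intro sum_mono2) (auto simp: N_def)
    ultimately show "(\<Sum>j\<le>n. norm (A i j * x j)) \<le> sqrt (lam\<^sup>2 * X)"
      using A0 by (simp add: abs_mult)
  qed auto
  define y where "y = mat_apply A x"
  have ypart: "(\<Sum>i\<le>K. (y i)\<^sup>2) \<le> lam\<^sup>2 * X" for K
  proof (rule LIMSEQ_le_const2)
    show "(\<lambda>N. \<Sum>i\<le>K. (\<Sum>j\<le>N. A i j * x j)\<^sup>2) \<longlonglongrightarrow> (\<Sum>i\<le>K. (y i)\<^sup>2)"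
      unfolding y_def mat_apply_def by (intro tendsto_intros summable_LIMSEQ' rows)
    show "\<exists>N. \<forall>n\<ge>N. (\<Sum>i\<le>K. (\<Sum>j\<le>n. A i j * x j)\<^sup>2) \<le> lam\<^sup>2 * X"
      using sec by blast
  qed
  have ys: "summable (\<lambda>n. (y n)\<^sup>2)"
    by (rule bounded_imp_summable[OF _ ypart]) auto
  have "(\<Sum>n. (y n)\<^sup>2) \<le> lam\<^sup>2 * X"
    by (rule LIMSEQ_le_const2[OF summable_LIMSEQ'[OF ys]]) (use ypart in auto)
  then have "sqrt (\<Sum>n. (y n)\<^sup>2) \<le> lam * sqrt X"
    using lam0 by (metis real_sqrt_le_mono real_sqrt_mult real_sqrt_unique)
  then show "ell2_norm (mat_apply A x) / ell2_norm x \<le> ereal lam"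
    using X0 ys xin by (simp add: ell2_norm_def y_def[symmetric] ell2_def X_def[symmetric] field_simps)
qed

text \<open>
  The increments \<open>p\<close> of \<open>g\<close> serve as Schur weights. Extending a row sum from \<open>N\<close> to \<open>Suc N\<close> adds
  \<open>a (Suc N) * p (Suc N)\<close>, and the supersolution inequality at \<open>N\<close> says precisely that this keeps
  the row sum below \<open>lam * p i\<close> minus the defect \<open>lam * p N - a N * g (Suc N)\<close>, which is
  nonnegative by the boundary hypothesis.
\<close>

lemma L_matrix_opnorm_le:
  fixes a g :: "nat \<Rightarrow> real"
  assumes a0: "\<And>n. 0 \<le> a n" and lam0: "0 \<le> lam" and g0: "g 0 = 0"
    and incr: "\<And>n. g n < g (Suc n)"
    and bdry: "\<And>n. a n * g (Suc n) \<le> lam * (g (Suc n) - g n)"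
    and super: "\<And>n. (a n - a (Suc n)) * g (Suc n) \<le> lam * (2 * g (Suc n) - g n - g (Suc (Suc n)))"
  shows "ell2_opnorm (L_matrix a) \<le> ereal lam"
proof (rule ell2_opnorm_le_finite_sections)
  show "0 \<le> L_matrix a i j" for i j
    using a0 by (simp add: L_matrix_def)
  define p where "p n = g (Suc n) - g n" for n
  have psum: "(\<Sum>j\<le>n. p j) = g (Suc n)" for n
    by (induction n) (simp_all add: p_def g0)
  have tail: "(\<Sum>j\<le>N. L_matrix a i j * p j) \<le> lam * p i - (lam * p N - a N * g (Suc N))"
    if "i \<le> N" for i N
    using that
  proof (induction rule: dec_induct)
    case base
    have "(\<Sum>j\<le>i. L_matrix a i j * p j) = a i * g (Suc i)"
      unfolding psum[symmetric] by (simp add: L_matrix_def sum_distrib_left max_def)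
    then show ?case by simp
  next
    case (step n)
    then have "L_matrix a i (Suc n) = a (Suc n)"
      by (simp add: L_matrix_def max_def)
    then show ?case
      using step.IH super[of n] by (simp add: p_def algebra_simps)
  qed
  show "(\<Sum>i\<le>N. (\<Sum>j\<le>N. L_matrix a i j * x j)\<^sup>2) \<le> lam\<^sup>2 * (\<Sum>j\<le>N. (x j)\<^sup>2)" for x N
  proof (rule Schur_test_finite)
    show "(\<Sum>j\<le>N. L_matrix a i j * p j) \<le> lam * p i" if "i \<le> N" for i
      using tail[OF that] bdry[of N] by (simp add: p_def)
  qed (use a0 incr in \<open>auto simp: L_matrix_def max.commute p_def\<close>)
qed (fact lam0)

section \<open>Comparison sequences of square-root growth\<close>

text \<open>The quotient of the Pochhammer symbols of \<open>c + 1/2\<close> and \<open>c\<close>.\<close>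

definition half_ratio :: "real \<Rightarrow> nat \<Rightarrow> real" where
  "half_ratio c n = (\<Prod>k<n. (real k + c + 1/2) / (real k + c))"

lemma half_ratio_0 [simp]: "half_ratio c 0 = 1"
  by (simp add: half_ratio_def)

lemma half_ratio_Suc:
  "half_ratio c (Suc n) = half_ratio c n * ((real n + c + 1/2) / (real n + c))"
  by (simp add: half_ratio_def)

lemma half_ratio_pos: "0 < c \<Longrightarrow> 0 < half_ratio c n"
  unfolding half_ratio_def by (intro prod_pos) (auto intro!: divide_pos_pos add_nonneg_pos)

lemma half_ratio_increment:
  assumes "0 < c"
  shows "half_ratio c (Suc n) - half_ratio c n = half_ratio c (Suc n) / (2 * (real n + c + 1/2))"
proof -
  have "real n + c > 0" using assms by simp
  then show ?thesis by (simp add: half_ratio_Suc divide_simps) (simp add: algebra_simps)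
qed

text \<open>
  Both increments next to \<open>n + 1\<close> are explicit multiples of the middle value, with factors
  \<open>1 / (2 t + 1)\<close> and \<open>1 / (2 t + 2)\<close> for \<open>t = n + c\<close>. Their difference is the
  critical weight, with constant exactly \<open>1/4\<close>, up to a shift of \<open>n\<close>.
\<close>

lemma half_ratio_recurrence:
  assumes "0 < c"
  shows "4 * (2 * half_ratio c (Suc n) - half_ratio c n - half_ratio c (Suc (Suc n)))
     = half_ratio c (Suc n) / ((real n + c + 1) * (real n + c + 1/2))"
proof -
  define t where "t = real n + c"
  have t: "t > 0" using assms by (simp add: t_def)
  have 1: "half_ratio c (Suc n) - half_ratio c n = half_ratio c (Suc n) / (2 * (t + 1/2))"
    using half_ratio_increment[OF assms, of n] by (simp add: t_def)
  have 2: "half_ratio c (Suc (Suc n)) - half_ratio c (Suc n) = half_ratio c (Suc n) / (2 * (t + 1))"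
    unfolding half_ratio_Suc[of c "Suc n"] using t by (simp add: t_def divide_simps) (simp add: algebra_simps)
  have "4 * (2 * half_ratio c (Suc n) - half_ratio c n - half_ratio c (Suc (Suc n)))
      = half_ratio c (Suc n) * (4 * (1 / (2 * (t + 1/2)) - 1 / (2 * (t + 1))))"
    using 1 2 by (simp add: algebra_simps)
  also have "4 * (1 / (2 * (t + 1/2)) - 1 / (2 * (t + 1))) = 1 / ((t + 1) * (t + 1/2))"
    using t by (simp add: divide_simps) (simp add: algebra_simps)
  finally show ?thesis by (simp add: t_def)
qed

lemma half_ratio_sq_le:
  assumes "5/4 \<le> c"
  shows "(half_ratio c n)\<^sup>2 \<le> real n + 1"
proof (induction n)
  case (Suc n)
  define t where "t = real n + c"
  have t: "real n + 5/4 \<le> t" using assms by (simp add: t_def)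
  have "(real n + 1) * (4 * t + 1) \<le> (t - 1/4) * (4 * t + 1)"
    using t by (intro mult_right_mono) auto
  also have "\<dots> \<le> 4 * t\<^sup>2" by (simp add: power2_eq_square algebra_simps)
  finally have "(real n + 1) * ((t + 1/2) / t)\<^sup>2 \<le> real n + 2"
    using t by (simp add: divide_simps power2_eq_square) (simp add: algebra_simps)
  moreover have "(half_ratio c n)\<^sup>2 * ((t + 1/2) / t)\<^sup>2 \<le> (real n + 1) * ((t + 1/2) / t)\<^sup>2"
    by (intro mult_right_mono Suc.IH) auto
  ultimately show ?case
    unfolding half_ratio_Suc power_mult_distrib t_def by simp
qed simp

text \<open>Criticality of the comparison recurrence: the terms dominate \<open>1 / (k + 2)\<close>, since squares of
  \<^const>\<open>half_ratio\<close> grow at most linearly.\<close>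

lemma half_ratio_reciprocal_diverges:
  assumes "5/4 \<le> c"
  shows "\<not> summable (\<lambda>k. 1 / (half_ratio c k * half_ratio c (Suc k)))"
proof
  assume *: "summable (\<lambda>k. 1 / (half_ratio c k * half_ratio c (Suc k)))"
  have c: "0 < c" using assms by simp
  have "summable (\<lambda>k. 1 / real (k + 2))"
  proof (rule summable_comparison_test'[OF *])
    fix k :: nat
    have mono: "half_ratio c k \<le> half_ratio c (Suc k)"
      using half_ratio_increment[OF c, of k] half_ratio_pos[OF c, of "Suc k"] c
      by (smt (verit) divide_nonneg_pos of_nat_0_le_iff)
    have "half_ratio c k * half_ratio c (Suc k) \<le> (half_ratio c (Suc k))\<^sup>2"
      unfolding power2_eq_square using mono half_ratio_pos[OF c, of "Suc k"] by (intro mult_right_mono) auto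
    also have "\<dots> \<le> real (k + 2)"
      using half_ratio_sq_le[OF assms, of "Suc k"] by simp
    finally show "norm (1 / real (k + 2)) \<le> 1 / (half_ratio c k * half_ratio c (Suc k))"
      using half_ratio_pos[OF c] by (auto intro!: divide_left_mono mult_pos_pos)
  qed
  then have "summable (\<lambda>k. inverse (real (k + 2)))"
    by (simp add: inverse_eq_divide)
  then have "summable (\<lambda>k. inverse (real k))"
    by (subst (asm) summable_iff_shift)
  then show False
    using not_summable_harmonic[where 'a = real] by simp
qed

text \<open>Reduction of order: the discrete analogue of \<open>h * (1 - c * \<integral> 1 / h\<^sup>2)\<close>.\<close>

definition second_solution :: "(nat \<Rightarrow> real) \<Rightarrow> real \<Rightarrow> nat \<Rightarrow> real" where
  "second_solution h c n = h n * (1 - c * (\<Sum>k<n. 1 / (h k * h (Suc k))))"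

text \<open>Any positive \<open>h\<close> solves a recurrence with the coefficient below; the Casoratian of \<open>h\<close> and the
  second solution is constant, so the contributions of the two new summands cancel.\<close>

lemma second_solution_recurrence:
  assumes h: "\<And>n. 0 < h n"
  shows "second_solution h c (Suc (Suc n)) + second_solution h c n
    = (h (Suc (Suc n)) + h n) / h (Suc n) * second_solution h c (Suc n)"
  using h[of n] h[of "Suc n"] h[of "Suc (Suc n)"]
  by (simp add: second_solution_def field_simps)

lemma second_solution_nonpos:
  assumes h: "\<And>n. 0 < h n" and c: "0 < c"
    and div: "\<not> summable (\<lambda>k. 1 / (h k * h (Suc k)))"
  shows "\<exists>n. second_solution h c n \<le> 0"
proof (rule ccontr)
  assume "\<nexists>n. second_solution h c n \<le> 0"
  then have pos: "0 < second_solution h c n" for n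
    by (simp add: not_le)
  have "(\<Sum>k<n. 1 / (h k * h (Suc k))) \<le> 1 / c" for n
  proof -
    have "0 < 1 - c * (\<Sum>k<n. 1 / (h k * h (Suc k)))"
      using pos[of n] h[of n] unfolding second_solution_def by (metis zero_less_mult_pos)
    then show ?thesis using c by (simp add: pos_le_divide_eq mult.commute)
  qed
  then have "summable (\<lambda>k. 1 / (h k * h (Suc k)))"
    using h by (intro summableI_nonneg_bounded) (auto simp: less_imp_le)
  with div show False ..
qed

section \<open>The norm around the value 4\<close>

lemma A_mat_weight:
  fixes s :: real
  assumes "0 < s"
  shows "1 / (real n + s) - 1 / (real (Suc n) + s) = 1 / ((real n + s) * (real n + s + 1))"
proof -
  have "0 < real n + s" using assms by simp
  then show ?thesis by (simp add: divide_simps)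
qed

text \<open>
  The supersolution has an extra zero value in front, for the Dirichlet condition. A large shift \<open>c\<close>
  helps at \<open>n = 0\<close>, where \<open>1 / (s (s + 1)) \<le> 4 - 2 / c\<close> is needed, and hurts for \<open>n \<ge> 1\<close>, where
  \<open>(n + c) (n + c - 1/2) \<le> (n + s) (n + s + 1)\<close> is needed and \<open>n = 1\<close> is the tightest case.
  The choice \<open>c = 21/20\<close> meets both for \<open>s\<close> down to \<open>707/2000\<close>, just below \<open>1 / (2 \<surd>2)\<close>.
\<close>

lemma A_mat_opnorm_le_4:
  fixes s :: real
  assumes s: "707/2000 \<le> s"
  shows "ell2_opnorm (A_mat s) \<le> 4"
proof -
  define c :: real where "c = 21/20"
  define g where "g n = (if n = 0 then 0 else half_ratio c (n - 1))" for n
  have c: "0 < c" by (simp add: c_def)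
  have g_Suc [simp]: "g (Suc n) = half_ratio c n" for n by (simp add: g_def)
  have g_0 [simp]: "g 0 = 0" by (simp add: g_def)
  have s0: "0 < s" using s by simp
  have incr: "g (Suc (Suc n)) - g (Suc n) = half_ratio c (Suc n) / (2 * (real n + c + 1/2))" for n
    using half_ratio_increment[OF c, of n] by simp
  have "ell2_opnorm (L_matrix (\<lambda>n. 1 / (real n + s))) \<le> ereal 4"
  proof (rule L_matrix_opnorm_le)
    show "g n < g (Suc n)" for n
    proof (cases n)
      case 0
      then show ?thesis by simp
    next
      case (Suc m)
      have "0 < half_ratio c (Suc m) / (2 * (real m + c + 1/2))"
        using half_ratio_pos[OF c] c by (intro divide_pos_pos) auto
      then show ?thesis using incr[of m] by (simp add: Suc)
    qed
    show "1 / (real n + s) * g (Suc n) \<le> 4 * (g (Suc n) - g n)" for n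
    proof (cases n)
      case 0
      then show ?thesis using s by (simp add: divide_simps)
    next
      case (Suc m)
      have "real m + c + 1/2 \<le> 2 * (real (Suc m) + s)" using s by (simp add: c_def)
      then have "1 / (real (Suc m) + s) \<le> 4 / (2 * (real m + c + 1/2))"
        using s0 c by (simp add: divide_simps)
      then have "1 / (real (Suc m) + s) * half_ratio c (Suc m)
          \<le> 4 / (2 * (real m + c + 1/2)) * half_ratio c (Suc m)"
        using half_ratio_pos[OF c, of "Suc m"] by (intro mult_right_mono) auto
      also have "\<dots> = 4 * (g (Suc (Suc m)) - g (Suc m))" using incr[of m] by simp
      finally show ?thesis by (simp add: Suc)
    qed
    show "(1 / (real n + s) - 1 / (real (Suc n) + s)) * g (Suc n)
        \<le> 4 * (2 * g (Suc n) - g n - g (Suc (Suc n)))" for n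
    proof (cases n)
      case 0
      have "(707/2000) * (707/2000 + 1) \<le> s * (s + 1)"
        using s by (intro mult_mono) auto
      then have "1 / (s * (s + 1)) \<le> 44 / 21"
        using s0 by (simp add: divide_simps)
      then show ?thesis
        unfolding A_mat_weight[OF s0] by (simp add: 0 half_ratio_Suc c_def)
    next
      case (Suc m)
      have "(real m + c + 1) * (real m + c + 1/2) \<le> (real m + 1 + 707/2000) * (real m + 2 + 707/2000)"
        by (simp add: c_def algebra_simps)
      also have "\<dots> \<le> (real m + 1 + s) * (real m + 2 + s)"
        using s by (intro mult_mono) auto
      finally have "1 / ((real m + 1 + s) * (real m + 2 + s)) \<le> 1 / ((real m + c + 1) * (real m + c + 1/2))"
        using c s0 by (intro divide_left_mono) (auto intro!: mult_pos_pos add_nonneg_pos)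
      then have "1 / ((real m + 1 + s) * (real m + 2 + s)) * half_ratio c (Suc m)
          \<le> 1 / ((real m + c + 1) * (real m + c + 1/2)) * half_ratio c (Suc m)"
        using half_ratio_pos[OF c, of "Suc m"] by (intro mult_right_mono) auto
      then show ?thesis
        unfolding A_mat_weight[OF s0]
        unfolding Suc g_Suc half_ratio_recurrence[OF c] by (simp add: add_ac)
    qed
  qed (use s0 in auto)
  then show ?thesis by (simp add: A_mat_def)
qed

lemma sum_inverse_sqrt_ge: "2 * (sqrt (real n + 2) - 1) \<le> (\<Sum>j\<le>n. 1 / sqrt (real j + 1))"
proof (induction n)
  case 0
  have "sqrt 2 \<le> 3/2" by (rule real_le_lsqrt) (auto simp: power2_eq_square)
  then show ?case by simp
next
  case (Suc n)
  have "2 * (sqrt (real n + 3) - sqrt (real n + 2)) \<le> 1 / sqrt (real n + 2)"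
  proof -
    have "sqrt (real n + 3) * sqrt (real n + 2) \<le> real n + 5/2"
      unfolding real_sqrt_mult[symmetric] by (rule real_le_lsqrt) (auto simp: power2_eq_square algebra_simps)
    then show ?thesis by (simp add: divide_simps) (simp add: algebra_simps)
  qed
  then show ?case using Suc.IH by (simp add: algebra_simps)
qed

text \<open>
  The vector \<open>x\<^sub>j = 1 / \<surd>(j + 1)\<close> has partial sums about \<open>2 \<surd>n\<close>, so both \<open>\<parallel>x\<parallel>\<^sup>2\<close> and a
  quarter of the form, over the first entries, are the harmonic sum up to a bounded error. As the
  harmonic sum is unbounded, the Rayleigh quotients of the truncations reach every number below \<open>4\<close>.
\<close>

lemma A_mat_opnorm_ge_4:
  fixes s :: real
  assumes s: "0 < s" "s \<le> 1"
  shows "4 \<le> ell2_opnorm (A_mat s)"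
proof -
  define x where "x j = 1 / sqrt (real j + 1)" for j :: nat
  define H where "H N = (\<Sum>n\<le>N. 1 / (real n + 1))" for N :: nat
  define e where "e n = 1 / ((real n + 1) * sqrt (real n + 2))" for n :: nat
  define Q where "Q N = (\<Sum>i\<le>N. \<Sum>j\<le>N. A_mat s i j * x i * x j)" for N
  have e_sum: "summable e"
  proof (rule summable_comparison_test')
    show "summable (\<lambda>n. real (n + 1) powr (- (3/2)))"
      by (subst summable_iff_shift) (simp add: summable_real_powr_iff)
    show "norm (e n) \<le> real (n + 1) powr (- (3/2))" for n
    proof -
      have "real (n + 1) powr (3/2) = real (n + 1) powr (1 + 1/2)" by simp
      also have "\<dots> = real (n + 1) * sqrt (real (n + 1))"
        unfolding powr_add by (simp add: powr_half_sqrt)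
      finally have eq: "real (n + 1) powr (- (3/2)) = 1 / ((real n + 1) * sqrt (real n + 1))"
        by (simp add: powr_minus divide_simps add_ac)
      have "1 / ((real n + 1) * sqrt (real n + 2)) \<le> 1 / ((real n + 1) * sqrt (real n + 1))"
        by (intro divide_left_mono mult_left_mono) auto
      then show ?thesis unfolding eq by (simp add: e_def)
    qed
  qed
  have e0: "0 \<le> e n" for n by (simp add: e_def)
  define E where "E = suminf e"
  have Ege: "(\<Sum>n<N. e n) \<le> E" for N
    unfolding E_def using e_sum e0 by (intro sum_le_suminf) auto
  have sq: "(x j)\<^sup>2 = 1 / (real j + 1)" for j
    by (simp add: x_def power_divide)
  have summand: "4 / (real n + 1) - 8 * e n
      \<le> (1 / (real n + s) - 1 / (real (Suc n) + s)) * (\<Sum>j\<le>n. x j)\<^sup>2" for n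
  proof -
    define q where "q = sqrt (real n + 2)"
    have q: "1 \<le> q" "q\<^sup>2 = real n + 2" by (auto simp: q_def)
    have "4 * ((real n + 2) - 2 * q) \<le> (2 * (q - 1))\<^sup>2"
      using q(2) by (simp add: power2_eq_square algebra_simps)
    also have "\<dots> \<le> (\<Sum>j\<le>n. x j)\<^sup>2"
      using sum_inverse_sqrt_ge[of n] q(1) by (intro power_mono) (auto simp: q_def x_def)
    finally have 1: "4 * ((real n + 2) - 2 * q) \<le> (\<Sum>j\<le>n. x j)\<^sup>2" .
    have "4 / (real n + 1) - 8 * e n = 1 / ((real n + 1) * (real n + 2)) * (4 * ((real n + 2) - 2 * q))"
    proof -
      have "e n = q / ((real n + 1) * q\<^sup>2)"
        using q(1) by (simp add: e_def q_def[symmetric] power2_eq_square)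
      then show ?thesis unfolding q(2) by (simp add: divide_simps) (simp add: algebra_simps)
    qed
    also have "\<dots> \<le> 1 / ((real n + 1) * (real n + 2)) * (\<Sum>j\<le>n. x j)\<^sup>2"
      by (intro mult_left_mono 1) auto
    also have "\<dots> \<le> 1 / ((real n + s) * (real n + s + 1)) * (\<Sum>j\<le>n. x j)\<^sup>2"
      using s by (intro mult_right_mono divide_left_mono mult_mono) (auto intro!: mult_pos_pos add_nonneg_pos)
    finally show ?thesis unfolding A_mat_weight[OF s(1)] .
  qed
  have Qge: "4 * H N - (4 + 8 * E) \<le> Q N" for N
  proof -
    have "H N = (\<Sum>n<N. 1 / (real n + 1)) + 1 / (real N + 1)"
      unfolding H_def by (simp add: lessThan_Suc_atMost[symmetric])
    moreover have "1 / (real N + 1) \<le> 1" by simp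
    moreover have "8 * (\<Sum>n<N. e n) \<le> 8 * E" using Ege[of N] by simp
    ultimately have "4 * H N - (4 + 8 * E) \<le> 4 * (\<Sum>n<N. 1 / (real n + 1)) - 8 * (\<Sum>n<N. e n)"
      by linarith
    also have "\<dots> = (\<Sum>n<N. 4 / (real n + 1) - 8 * e n)"
      by (simp add: sum_subtractf sum_distrib_left)
    also have "\<dots> \<le> (\<Sum>n<N. (1 / (real n + s) - 1 / (real (Suc n) + s)) * (\<Sum>j\<le>n. x j)\<^sup>2)"
      by (intro sum_mono summand)
    also have "\<dots> \<le> Q N"
      unfolding Q_def A_mat_def L_matrix_form using s(1) by simp
    finally show ?thesis .
  qed
  have H1: "1 \<le> H N" for N
    unfolding H_def using member_le_sum[of 0 "{..N}" "\<lambda>n. 1 / (real n + 1)"] by simp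
  show ?thesis
  proof (rule ccontr)
    assume "\<not> 4 \<le> ell2_opnorm (A_mat s)"
    then obtain d where d: "ell2_opnorm (A_mat s) < ereal d" "ereal d < 4"
      using ereal_dense2[of "ell2_opnorm (A_mat s)" 4] by (auto simp: not_le)
    have bound: "H N \<le> (4 + 8 * E) / (4 - d)" for N
    proof -
      have "ereal (Q N / H N) \<le> ell2_opnorm (A_mat s)"
        using Rayleigh_le_ell2_opnorm[where A = "A_mat s" and x = x and N = N] H1[of N]
        by (simp add: sq Q_def H_def)
      from this d(1) have "ereal (Q N / H N) < ereal d" by (rule le_less_trans)
      then have "Q N < d * H N"
        using H1[of N] by (simp add: divide_simps split: if_splits)
      then have "(4 - d) * H N \<le> 4 + 8 * E"
        using Qge[of N] by (simp add: algebra_simps)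
      then show ?thesis
        using d(2) by (simp add: pos_le_divide_eq mult.commute)
    qed
    have "summable (\<lambda>n. 1 / (real n + 1))"
      by (rule bounded_imp_summable[OF _ bound[unfolded H_def]]) simp
    then have "summable (\<lambda>n. inverse (real (n + 1)))"
      by (simp add: inverse_eq_divide add_ac)
    then have "summable (\<lambda>n. inverse (real n))"
      by (subst (asm) summable_iff_shift)
    then show False
      using not_summable_harmonic[where 'a = real] by simp
  qed
qed

text \<open>
  The weights decrease in \<open>s\<close>, so a subsolution for \<open>s = 139/400\<close> serves all smaller \<open>s\<close>. The
  values \<open>1\<close>, \<open>1.4662\<close>, \<open>1.8166\<close> follow the exact recurrence at \<open>139/400\<close>, rounded upwards to
  keep the inequality. From there on \<open>T\<close> is a second solution of the recurrence of
  \<open>half_ratio (31/10)\<close>, whose weight is at most the true one at every later index. The subsolution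
  inequality at the junction asks for a next ratio of at least about \<open>1.1611\<close>, while
  \<open>half_ratio (31/10)\<close> offers \<open>36/31 > 1.1612\<close>. This slack leaves room for the parameter
  \<open>1/10000 > 0\<close> of the second solution, and any positive parameter makes it change sign.
\<close>

lemma A_mat_opnorm_gt_4:
  fixes s :: real
  assumes s: "0 < s" "s \<le> 139/400"
  shows "4 < ell2_opnorm (A_mat s)"
proof -
  define h where "h = half_ratio (31/10)"
  define f where "f = second_solution h (1/10000)"
  define T :: "nat \<Rightarrow> real" where
    "T n = (if n = 0 then 0 else if n = 1 then 1 else if n = 2 then 14662/10000
            else 18166/10000 * f (n - 3))" for n
  have hpos: "0 < h n" for n unfolding h_def by (rule half_ratio_pos) simp
  have w: "1 / ((real k + 139/400) * (real k + 539/400))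
        \<le> 1 / (real k + s) - 1 / (real (Suc k) + s)" for k
    unfolding A_mat_weight[OF s(1)] using s
    by (intro divide_left_mono mult_mono) (auto intro!: mult_pos_pos add_nonneg_pos)
  have f0: "f 0 = 1" by (simp add: f_def second_solution_def h_def)
  have f1: "f 1 = 36/31 - 1/10000"
    by (simp add: f_def second_solution_def h_def half_ratio_Suc)
  have T_Suc3: "T (Suc (Suc (Suc m))) = 18166/10000 * f m" for m by (simp add: T_def)
  have T0: "T 0 = 0" and T1: "T 1 = 1" and T2: "T 2 = 14662/10000" and T3: "T 3 = 18166/10000"
    by (simp_all add: T_def f0)
  have T4: "T 4 = 18166/10000 * (36/31 - 1/10000)"
    using f1 by (simp add: T_def)
  have rec: "4 * (2 * f (Suc m) - f m - f (Suc (Suc m)))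
      = f (Suc m) * (1 / ((real m + 41/10) * (real m + 36/10)))" for m
  proof -
    have "4 * (2 * h (Suc m) - h m - h (Suc (Suc m))) = h (Suc m) / ((real m + 41/10) * (real m + 36/10))"
      unfolding h_def using half_ratio_recurrence[of "31/10" m] by (simp add: algebra_simps)
    then have "4 * (h (Suc (Suc m)) + h m) = (8 - 1 / ((real m + 41/10) * (real m + 36/10))) * h (Suc m)"
      by (simp add: left_diff_distrib)
    then have ratio: "4 * ((h (Suc (Suc m)) + h m) / h (Suc m)) = 8 - 1 / ((real m + 41/10) * (real m + 36/10))"
      using hpos[of "Suc m"] by (simp add: nonzero_divide_eq_eq)
    have "4 * (f (Suc (Suc m)) + f m) = 4 * ((h (Suc (Suc m)) + h m) / h (Suc m)) * f (Suc m)"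
      unfolding f_def second_solution_recurrence[of h, OF hpos] by simp
    then show ?thesis
      unfolding ratio by (simp add: left_diff_distrib)
  qed
  have strict: "4 * (2 * T 1 - T 2) < (1 / (real 0 + s) - 1 / (real 1 + s)) * T 1"
  proof -
    have "4 * (2 * 1 - 14662/10000) < (1 / ((real 0 + 139/400) * (real 0 + 539/400)) :: real)"
      by simp
    then show ?thesis using w[of 0] unfolding T1 T2 by simp
  qed
  have "ereal 4 < ell2_opnorm (L_matrix (\<lambda>n. 1 / (real n + s)))"
  proof (rule L_matrix_opnorm_gt[where T = T])
    show "4 * (2 * T (Suc k) - T k - T (Suc (Suc k)))
      \<le> (1 / (real k + s) - 1 / (real (Suc k) + s)) * T (Suc k)" if "0 < T (Suc k)" for k
    proof -
      have "4 * (2 * T (Suc k) - T k - T (Suc (Suc k)))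
          \<le> 1 / ((real k + 139/400) * (real k + 539/400)) * T (Suc k)"
      proof -
        consider "k = 0" | "k = 1" | "k = 2" | m where "k = Suc (Suc (Suc m))"
          by (metis One_nat_def Suc_1 not0_implies_Suc)
        then show ?thesis
        proof cases
          case 1
          then show ?thesis using T0 T1 T2 by (simp add: numeral_2_eq_2)
        next
          case 2
          then show ?thesis using T1 T2 T3 by (simp add: numeral_2_eq_2 numeral_3_eq_3)
        next
          case 3
          then show ?thesis using T2 T3 T4 by (simp add: numeral_eq_Suc)
        next
          case (4 m)
          have fpos: "0 < f (Suc m)" using that by (simp add: 4 T_Suc3)
          define D where "D = (real k + 139/400) * (real k + 539/400)"
          have D: "D = (real m + 3 + 139/400) * (real m + 3 + 539/400)"
            by (simp add: D_def 4 add_ac)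
          have "(real m + 3 + 139/400) * (real m + 3 + 539/400) \<le> (real m + 41/10) * (real m + 36/10)"
            by (simp add: algebra_simps)
          then have "1 / ((real m + 41/10) * (real m + 36/10)) \<le> 1 / D"
            unfolding D by (intro divide_left_mono) (auto intro!: mult_pos_pos add_nonneg_pos)
          then have "4 * (2 * f (Suc m) - f m - f (Suc (Suc m))) \<le> f (Suc m) * (1 / D)"
            unfolding rec using fpos by (intro mult_left_mono) auto
          define K :: real where "K = 18166/10000"
          have "K * (4 * (2 * f (Suc m) - f m - f (Suc (Suc m)))) \<le> K * (f (Suc m) * (1 / D))"
            by (intro mult_left_mono) (fact, simp add: K_def)
          then show ?thesis
            unfolding D_def[symmetric] unfolding 4 T_Suc3 K_def[symmetric] by (simp add: algebra_simps)
        qed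
      qed
      also have "\<dots> \<le> (1 / (real k + s) - 1 / (real (Suc k) + s)) * T (Suc k)"
        using w[of k] that by (intro mult_right_mono) auto
      finally show ?thesis .
    qed
    obtain n where "f n \<le> 0"
      using second_solution_nonpos[of h "1/10000", OF hpos] half_ratio_reciprocal_diverges[of "31/10"]
      by (auto simp: f_def h_def)
    then have "T (Suc (Suc (Suc n))) \<le> 0" by (simp add: T_Suc3)
    then show "\<exists>n>0. T n \<le> 0" by blast
  qed (use T0 T1 strict in auto)
  then show ?thesis by (simp add: A_mat_def)
qed

theorem theorem2p2:
  shows "(sqrt (6 * (8 + 3 * sqrt 3)) - sqrt 3 - 3) / 12 \<le> s0 \<and> s0 \<le> 1 / (2 * sqrt 2)"
proof -
  let ?S = "{s. s > 0 \<and> ell2_opnorm (A_mat s) = 4}"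
  let ?u = "1 / (2 * sqrt 2) :: real"
  let ?l = "(sqrt (6 * (8 + 3 * sqrt 3)) - sqrt 3 - 3) / 12 :: real"
  have "sqrt 2 \<le> 1000/707" by (rule real_le_lsqrt) (auto simp: power2_eq_square)
  then have u1: "707/2000 \<le> ?u" by (simp add: divide_simps)
  have "1 \<le> sqrt (2::real)" by simp
  then have "1 \<le> 2 * sqrt (2::real)" by linarith
  then have u2: "?u \<le> 1" by (simp add: divide_simps)
  have "ell2_opnorm (A_mat ?u) = 4"
    using u1 u2 by (intro antisym A_mat_opnorm_le_4 A_mat_opnorm_ge_4) auto
  then have mem: "?u \<in> ?S" by simp
  \<comment> \<open>The claimed bound is about \<open>0.34717\<close>, strictly inside the range where the norm exceeds \<open>4\<close>.\<close>
  have l: "?l \<le> 139/400"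
  proof -
    have r3: "sqrt 3 \<le> (7/4::real)" by (rule real_le_lsqrt) (auto simp: power2_eq_square)
    have "sqrt (6 * (8 + 3 * sqrt 3)) \<le> 717/100 + sqrt 3"
    proof (rule real_le_lsqrt)
      show "6 * (8 + 3 * sqrt 3) \<le> (717/100 + sqrt 3)\<^sup>2"
        using r3 by (simp add: power2_eq_square algebra_simps)
    qed simp
    then show ?thesis by simp
  qed
  have "?l \<le> s0"
    unfolding s0_def
  proof (rule cInf_greatest)
    show "?l \<le> s" if "s \<in> ?S" for s
    proof (rule ccontr)
      assume "\<not> ?l \<le> s"
      with l have "s \<le> 139/400" by linarith
      then show False using A_mat_opnorm_gt_4[of s] that by simp
    qed
  qed (use mem in blast)
  moreover have "s0 \<le> ?u"
    unfolding s0_def by (rule cInf_lower[OF mem]) (auto intro!: bdd_belowI[of _ 0])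
  ultimately show ?thesis ..
qed

end
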